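(* Let $F\in SL(d,\mathbb{Z})$, acting on $\mathbb{T}^d$, be partially hyperbolic with invariant splitting $\mathbb{R}^d=S\oplus C\oplus U$. Suppose that for every smooth function $\varphi:\mathbb{T}^d\to\mathbb{R}$ with $\operatorname{PCF}_\gamma\varphi=0$ for every $su$-cycle $\gamma$ of $F$, there exist a function $u:\mathbb{T}^d\to\mathbb{R}$ and a constant $K$ with $\varphi(x)=u(Fx)-u(x)+K$ for all $x$. Then $F$ is Katznelson irreducible, i.e. $C\cap\mathbb{Z}^d=\{0\}$.
   Context: Partial hyperbolicity: for some metric, $\|F|_S\|<1$, $m(F|_U)>1$, $\|F|_S\|<m(F|_C)$, $m(F|_U)>\|F|_C\|$ ($m$ = conorm). The strong stable and unstable leaves of $F$ are $\mathcal{W}^{ss}(x)=x+S$, $\mathcal{W}^{uu}(x)=x+U$ (mod $\mathbb{Z}^d$). Holonomy functionals: for $x^+\in\mathcal{W}^{ss}(x)$, $\operatorname{Hol}_x^{x^+}\varphi=\sum_{n\ge0}(\varphi(F^nx)-\varphi(F^nx^+))$; for $x^-\in\mathcal{W}^{uu}(x)$, $\operatorname{Hol}_x^{x^-}\varphi=-\sum_{n\ge1}(\varphi(F^{-n}x)-\varphi(F^{-n}x^-))$. An $su$-cycle is $\gamma=(x_0,\dots,x_k)$ with $x_k=x_0$ and each $x_j\in\mathcal{W}^{ss}(x_{j-1})\cup\mathcal{W}^{uu}(x_{j-1})$; $\operatorname{PCF}_\gamma\varphi=\sum_{j=1}^k\operatorname{Hol}_{x_{j-1}}^{x_j}\varphi$.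 *)

theory Defs
  imports "HOL-Analysis.Analysis"
begin

section \<open>Smooth functions on R^d\<close>

text \<open>Iterated directional (Frechet) derivatives along a list of directions.\<close>
fun iter_dderiv :: "(real^'n) list \<Rightarrow> (real^'n \<Rightarrow> real) \<Rightarrow> (real^'n \<Rightarrow> real)" where
  "iter_dderiv [] f = f"
| "iter_dderiv (v # vs) f = (\<lambda>x. frechet_derivative (iter_dderiv vs f) (at x) v)"

text \<open>C-infinity: every iterated derivative exists and is differentiable everywhere.\<close>
definition smooth_fun :: "(real^'n \<Rightarrow> real) \<Rightarrow> bool" where
  "smooth_fun f \<longleftrightarrow> (\<forall>vs x. iter_dderiv vs f differentiable (at x))"

section \<open>The torus T^d = R^d / Z^d\<close>

definition int_vec :: "real^'n \<Rightarrow> bool" where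
  "int_vec k \<longleftrightarrow> (\<forall>i. k $ i \<in> \<int>)"

text \<open>Functions on the torus are represented as Z^d-periodic functions on R^d.\<close>
definition torus_fun :: "(real^'n \<Rightarrow> 'b) \<Rightarrow> bool" where
  "torus_fun f \<longleftrightarrow> (\<forall>x k. int_vec k \<longrightarrow> f (x + k) = f x)"

text \<open>F in SL(d,Z).\<close>
definition SL_int :: "real^'n^'n \<Rightarrow> bool" where
  "SL_int F \<longleftrightarrow> (\<forall>i j. F $ i $ j \<in> \<int>) \<and> det F = 1"

text \<open>Action of the matrix F (and its powers, including negative ones) on lifts.\<close>
definition Fpow :: "real^'n^'n \<Rightarrow> int \<Rightarrow> real^'n \<Rightarrow> real^'n" where
  "Fpow F n x = (if n \<ge> 0 then ((\<lambda>y. F *v y) ^^ nat n) x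
                 else ((\<lambda>y. matrix_inv F *v y) ^^ nat (- n)) x)"

section \<open>Partial hyperbolicity\<close>

text \<open>An adapted metric is a Euclidean norm x \<mapsto> norm (P x), P invertible.
  The norm / conorm inequalities are written out pointwise.\<close>
definition partially_hyperbolic ::
  "real^'n^'n \<Rightarrow> (real^'n) set \<Rightarrow> (real^'n) set \<Rightarrow> (real^'n) set \<Rightarrow> bool" where
  "partially_hyperbolic F S C U \<longleftrightarrow>
     subspace S \<and> subspace C \<and> subspace U \<and> S \<noteq> {0} \<and> U \<noteq> {0} \<and>
     (\<forall>x. \<exists>!scu. fst scu \<in> S \<and> fst (snd scu) \<in> C \<and> snd (snd scu) \<in> U \<and>
                  x = fst scu + fst (snd scu) + snd (snd scu)) \<and>
     (\<lambda>y. F *v y) ` S = S \<and> (\<lambda>y. F *v y) ` C = C \<and> (\<lambda>y. F *v y) ` U = U \<and>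
     (\<exists>P :: real^'n^'n. invertible P \<and>
        (let N = (\<lambda>v. norm (P *v v)) in
         \<exists>sS mC MC mU.
           sS < 1 \<and> mU > 1 \<and> sS < mC \<and> MC < mU \<and>
           (\<forall>v\<in>S. N (F *v v) \<le> sS * N v) \<and>
           (\<forall>v\<in>C. mC * N v \<le> N (F *v v) \<and> N (F *v v) \<le> MC * N v) \<and>
           (\<forall>v\<in>U. mU * N v \<le> N (F *v v))))"

section \<open>Holonomies and periodic cycle functionals\<close>

text \<open>Strong stable / unstable leaves on the torus, in terms of lifts.\<close>
definition Wss :: "(real^'n) set \<Rightarrow> real^'n \<Rightarrow> (real^'n) set" where
  "Wss S x = {y. \<exists>s\<in>S. int_vec (y - x - s)}"

definition Wuu :: "(real^'n) set \<Rightarrow> real^'n \<Rightarrow> (real^'n) set" where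
  "Wuu U x = {y. \<exists>u\<in>U. int_vec (y - x - u)}"

definition Hol_s :: "real^'n^'n \<Rightarrow> real^'n \<Rightarrow> real^'n \<Rightarrow> (real^'n \<Rightarrow> real) \<Rightarrow> real" where
  "Hol_s F x x' \<phi> = (\<Sum>n. \<phi> (Fpow F (int n) x) - \<phi> (Fpow F (int n) x'))"

definition Hol_u :: "real^'n^'n \<Rightarrow> real^'n \<Rightarrow> real^'n \<Rightarrow> (real^'n \<Rightarrow> real) \<Rightarrow> real" where
  "Hol_u F x x' \<phi> = - (\<Sum>n. \<phi> (Fpow F (- int (Suc n)) x) - \<phi> (Fpow F (- int (Suc n)) x'))"

text \<open>An su-cycle: start point x0 and a list of legs (x_j, b_j), where b_j = True
  means x_j lies on the strong stable leaf of x_(j-1), b_j = False the strong unstable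
  leaf; the last point equals x0 on the torus.\<close>
definition su_cycle ::
  "(real^'n) set \<Rightarrow> (real^'n) set \<Rightarrow> real^'n \<Rightarrow> ((real^'n) \<times> bool) list \<Rightarrow> bool" where
  "su_cycle S U x0 legs \<longleftrightarrow> legs \<noteq> [] \<and>
     (\<forall>j < length legs.
        (let prev = (if j = 0 then x0 else fst (legs ! (j - 1))); (y, b) = legs ! j in
         if b then y \<in> Wss S prev else y \<in> Wuu U prev)) \<and>
     int_vec (fst (last legs) - x0)"

definition PCF ::
  "real^'n^'n \<Rightarrow> real^'n \<Rightarrow> ((real^'n) \<times> bool) list \<Rightarrow> (real^'n \<Rightarrow> real) \<Rightarrow> real" where
  "PCF F x0 legs \<phi> = (\<Sum>j < length legs.
      (let prev = (if j = 0 then x0 else fst (legs ! (j - 1))); (y, b) = legs ! j in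
       if b then Hol_s F prev y \<phi> else Hol_u F prev y \<phi>))"

end

theory Submission
  imports Defs
begin

text \<open>Suppose k \<noteq> 0 is an integer vector in C. Take an integer relation
  \<Sum>i\<le>n. z i F^i k = 0 of least length and put Q = z(F), an integer matrix with Q k = 0.
  If Q s = 0 for some s in S or U, then F^i k \<mapsto> F^i s extends to a linear map
  intertwining F on the cyclic span of k, so the orbit of s (backward for S, forward for U)
  would grow at the rate of a centre vector, contradicting the gaps between the rates of the
  adapted norm. Thus Q is injective, hence onto, on S and on U, while Q is singular; so some
  integer m \<noteq> 0 annihilates the range of Q, which contains S and U. The Fourier mode
  \<phi> x = cos (2 \<pi> m \<bullet> x) is then invariant along strong stable and unstable leaves, all
  its holonomies and periodic cycle functionals vanish, and by hypothesis
  \<phi> = u \<circ> F - u + K. The fixed point 0 gives K = 1, but along the periodic orbit of a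
  rational point x0 with m \<bullet> x0 = 1/2 the Birkhoff sum of \<phi> is smaller than the period.\<close>

section \<open>Integer relations\<close>

lemma int_vec_0 [simp]: "int_vec 0"
  by (simp add: int_vec_def)

lemma int_vec_scaleR: "c \<in> \<int> \<Longrightarrow> int_vec a \<Longrightarrow> int_vec (c *\<^sub>R a)"
  by (simp add: int_vec_def)

lemma int_vec_sum: "(\<And>i. i \<in> I \<Longrightarrow> int_vec (f i)) \<Longrightarrow> int_vec (\<Sum>i\<in>I. f i)"
  unfolding int_vec_def by auto

lemma int_vec_axis: "int_vec (axis j 1)"
  by (simp add: int_vec_def axis_def)

lemma int_vec_inner: "int_vec m \<Longrightarrow> int_vec x \<Longrightarrow> m \<bullet> x \<in> \<int>"
  unfolding int_vec_def inner_vec_def by auto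

lemma int_vec_matrix_vector_mult:
  "(\<forall>i j. A $ i $ j \<in> \<int>) \<Longrightarrow> int_vec x \<Longrightarrow> int_vec ((A::real^'n^'m) *v x)"
  unfolding int_vec_def matrix_vector_mult_def by auto

lemma ex_nonzero_component: "(x::real^'n) \<noteq> 0 \<Longrightarrow> \<exists>l. x $ l \<noteq> 0"
  by (metis vec_eq_iff zero_index)

lemma relation_eliminate_pivot:
  fixes v :: "'i \<Rightarrow> real^'n"
  assumes "finite I" "n \<notin> I" "v n $ l \<noteq> 0" "(\<Sum>i\<in>insert n I. c i *\<^sub>R v i) = 0"
  shows "(\<Sum>i\<in>I. c i *\<^sub>R (v n $ l *\<^sub>R v i - v i $ l *\<^sub>R v n)) = 0"
proof -
  define \<kappa> where "\<kappa> = v n $ l * c n + (\<Sum>i\<in>I. c i * v i $ l)"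
  have "(\<Sum>i\<in>I. c i *\<^sub>R (v n $ l *\<^sub>R v i - v i $ l *\<^sub>R v n))
      = v n $ l *\<^sub>R (\<Sum>i\<in>I. c i *\<^sub>R v i) - (\<Sum>i\<in>I. c i * v i $ l) *\<^sub>R v n"
    by (simp add: scaleR_sum_right scaleR_sum_left sum_subtractf algebra_simps)
  also have "(\<Sum>i\<in>I. c i *\<^sub>R v i) = - (c n *\<^sub>R v n)"
    using assms by (simp add: eq_neg_iff_add_eq_0 add.commute)
  finally have rel: "(\<Sum>i\<in>I. c i *\<^sub>R (v n $ l *\<^sub>R v i - v i $ l *\<^sub>R v n)) = - \<kappa> *\<^sub>R v n"
    unfolding \<kappa>_def by (simp add: algebra_simps)
  moreover have "(\<Sum>i\<in>I. c i *\<^sub>R (v n $ l *\<^sub>R v i - v i $ l *\<^sub>R v n)) $ l = 0"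
    by simp
  ultimately have "\<kappa> = 0"
    using assms(3) by simp
  with rel show ?thesis
    by simp
qed

lemma relation_lift_pivot:
  fixes v :: "'i \<Rightarrow> real^'n"
  assumes "finite I" "n \<notin> I" "(\<Sum>i\<in>I. z i *\<^sub>R (p *\<^sub>R v i - v i $ l *\<^sub>R v n)) = 0"
  shows "(\<Sum>i\<in>insert n I. (if i = n then - (\<Sum>j\<in>I. z j * v j $ l) else p * z i) *\<^sub>R v i) = 0"
proof -
  have "(\<Sum>i\<in>insert n I. (if i = n then - (\<Sum>j\<in>I. z j * v j $ l) else p * z i) *\<^sub>R v i)
      = - (\<Sum>j\<in>I. z j * v j $ l) *\<^sub>R v n + (\<Sum>i\<in>I. (p * z i) *\<^sub>R v i)"
    using assms(1,2) by (auto intro!: sum.cong)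
  also have "\<dots> = (\<Sum>i\<in>I. z i *\<^sub>R (p *\<^sub>R v i - v i $ l *\<^sub>R v n))"
    by (simp add: scaleR_sum_right scaleR_sum_left sum_subtractf algebra_simps)
  finally show ?thesis
    using assms(3) by simp
qed

text \<open>Gaussian elimination: a pivot entry of one vector clears a coordinate of all the others
  while keeping the coefficients integral.\<close>
lemma int_vec_integer_relation:
  fixes v :: "'i \<Rightarrow> real^'n"
  assumes "finite I" "\<forall>i\<in>I. int_vec (v i)" "(\<Sum>i\<in>I. c i *\<^sub>R v i) = 0" "\<exists>i\<in>I. c i \<noteq> 0"
  shows "\<exists>z. (\<forall>i\<in>I. z i \<in> \<int>) \<and> (\<exists>i\<in>I. z i \<noteq> 0) \<and> (\<Sum>i\<in>I. z i *\<^sub>R v i) = 0"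
  using assms
proof (induction I arbitrary: c v rule: finite_induct)
  case empty
  then show ?case by simp
next
  case (insert n I)
  show ?case
  proof (cases "v n = 0")
    case True
    with insert.hyps show ?thesis
      by (intro exI[of _ "\<lambda>i. if i = n then 1 else 0"]) (auto intro!: sum.neutral)
  next
    case False
    then obtain l where pivot: "v n $ l \<noteq> 0"
      using ex_nonzero_component by blast
    define w where "w i = v n $ l *\<^sub>R v i - v i $ l *\<^sub>R v n" for i
    have "\<forall>i\<in>I. int_vec (w i)"
      using insert.prems(1) unfolding w_def int_vec_def by auto
    moreover have "(\<Sum>i\<in>I. c i *\<^sub>R w i) = 0"
      unfolding w_def using relation_eliminate_pivot[OF insert.hyps pivot insert.prems(2)] .
    moreover have "\<exists>i\<in>I. c i \<noteq> 0"
    proof (rule ccontr)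
      assume "\<not> (\<exists>i\<in>I. c i \<noteq> 0)"
      then have "c n *\<^sub>R v n = 0"
        using insert.prems(2) insert.hyps by simp
      then show False
        using insert.prems(3) \<open>\<not> (\<exists>i\<in>I. c i \<noteq> 0)\<close> False by auto
    qed
    ultimately obtain z where z: "\<forall>i\<in>I. z i \<in> \<int>" "\<exists>i\<in>I. z i \<noteq> 0" "(\<Sum>i\<in>I. z i *\<^sub>R w i) = 0"
      using insert.IH by blast
    let ?z = "\<lambda>i. if i = n then - (\<Sum>j\<in>I. z j * v j $ l) else v n $ l * z i"
    have "(\<Sum>i\<in>insert n I. ?z i *\<^sub>R v i) = 0"
      using relation_lift_pivot[OF insert.hyps] z(3) unfolding w_def by blast
    moreover have "\<forall>i\<in>insert n I. ?z i \<in> \<int>"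
      using z(1) insert.prems(1) unfolding int_vec_def by auto
    moreover have "\<exists>i\<in>insert n I. ?z i \<noteq> 0"
      using z(2) pivot insert.hyps by auto
    ultimately show ?thesis
      by (intro exI[of _ ?z]) blast
  qed
qed

lemma integer_left_kernel:
  fixes Q :: "real^'n \<Rightarrow> real^'n"
  assumes Q: "linear Q" and Q_int: "\<And>x. int_vec x \<Longrightarrow> int_vec (Q x)" and "\<not> inj Q"
  obtains m where "int_vec m" "m \<noteq> 0" "\<And>y. m \<bullet> Q y = 0"
proof -
  define A where "A = matrix Q"
  have AQ: "A *v y = Q y" for y
    unfolding A_def using matrix_works Q by (metis linear_matrix_vector_mul_eq)
  have "det A = 0"
    using \<open>\<not> inj Q\<close> det_nz_iff_inj[OF Q] unfolding A_def by blast
  then have "det (matrix ((*v) (transpose A))) = 0"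
    by simp
  then have "\<not> inj ((*v) (transpose A))"
    using det_nz_iff_inj[OF matrix_vector_mul_linear] by blast
  then obtain w where "w \<noteq> 0" "transpose A *v w = 0"
    using linear_inj_iff_eq_0[OF matrix_vector_mul_linear] by blast
  then have rows: "(\<Sum>i\<in>UNIV. w $ i *\<^sub>R A $ i) = 0"
    by (simp add: vec_eq_iff matrix_vector_mult_def transpose_def mult.commute)
  have "\<forall>i\<in>UNIV. int_vec (A $ i)"
    using Q_int[OF int_vec_axis] unfolding A_def int_vec_def matrix_def by simp
  moreover have "\<exists>i\<in>UNIV. w $ i \<noteq> 0"
    using ex_nonzero_component[OF \<open>w \<noteq> 0\<close>] by blast
  ultimately obtain z where z: "\<forall>i\<in>UNIV. z i \<in> \<int>" "\<exists>i\<in>UNIV. z i \<noteq> 0" "(\<Sum>i\<in>UNIV. z i *\<^sub>R A $ i) = 0"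
    using int_vec_integer_relation[OF finite_class.finite_UNIV _ rows] by blast
  define m where "m = (\<chi> i. z i)"
  have "m v* A = 0"
    using z(3) by (simp add: vec_eq_iff vector_matrix_mult_def m_def mult.commute)
  then have "m \<bullet> Q y = 0" for y
    by (metis AQ dot_lmul_matrix inner_zero_left)
  moreover have "int_vec m" "m \<noteq> 0"
    using z(1,2) unfolding m_def int_vec_def by (auto simp: vec_eq_iff)
  ultimately show thesis
    using that by blast
qed

definition independent_upto :: "(nat \<Rightarrow> 'a::real_vector) \<Rightarrow> nat \<Rightarrow> bool" where
  "independent_upto e n \<longleftrightarrow> (\<forall>c. (\<Sum>i<n. c i *\<^sub>R e i) = 0 \<longrightarrow> (\<forall>i<n. c i = 0))"

lemma independent_upto_inj_on:
  assumes "independent_upto e n"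
  shows "inj_on e {..<n}"
proof (rule inj_onI, rule ccontr)
  fix a b
  assume ab: "a \<in> {..<n}" "b \<in> {..<n}" "e a = e b" "a \<noteq> b"
  define c where "c i = (if i = a then 1 else 0) - (if i = b then 1 else (0::real))" for i
  have "(\<Sum>i<n. c i *\<^sub>R e i) = (\<Sum>i<n. (if i = a then e i else 0) - (if i = b then e i else 0))"
    by (intro sum.cong) (auto simp: c_def)
  also have "\<dots> = (\<Sum>i<n. (if i = a then e i else 0)) - (\<Sum>i<n. (if i = b then e i else 0))"
    by (simp add: sum_subtractf)
  also have "\<dots> = 0"
    using ab by simp
  finally have "c a = 0"
    using spec[OF assms[unfolded independent_upto_def], of c] ab(1) by simp
  then show False
    using ab(4) by (simp add: c_def)
qed

lemma independent_upto_independent: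
  assumes "independent_upto e n"
  shows "independent (e ` {..<n})"
proof (rule independent_if_scalars_zero)
  fix c v
  assume "(\<Sum>v\<in>e ` {..<n}. c v *\<^sub>R v) = 0" "v \<in> e ` {..<n}"
  moreover have "(\<Sum>v\<in>e ` {..<n}. c v *\<^sub>R v) = (\<Sum>i<n. c (e i) *\<^sub>R e i)"
    using independent_upto_inj_on[OF assms] by (simp add: sum.reindex)
  ultimately have "\<forall>i<n. c (e i) = 0"
    using spec[OF assms[unfolded independent_upto_def], of "\<lambda>i. c (e i)"] by simp
  then show "c v = 0"
    using \<open>v \<in> e ` {..<n}\<close> by auto
qed simp

lemma independent_upto_le_DIM:
  fixes e :: "nat \<Rightarrow> 'a::euclidean_space"
  assumes "independent_upto e n"
  shows "n \<le> DIM('a)"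
  using independent_bound[OF independent_upto_independent[OF assms]]
    card_image[OF independent_upto_inj_on[OF assms]] by simp

lemma minimal_integer_relation:
  fixes e :: "nat \<Rightarrow> real^'n"
  assumes e_int: "\<And>i. int_vec (e i)" and e0: "e 0 \<noteq> 0"
  obtains n z where "0 < n" "independent_upto e n" "z n \<noteq> 0" "\<forall>i\<le>n. z i \<in> \<int>"
    "(\<Sum>i\<le>n. z i *\<^sub>R e i) = 0"
proof -
  have "\<exists>n. \<not> independent_upto e (Suc n)"
    using independent_upto_le_DIM[of e "Suc DIM(real^'n)"] by auto
  define n where "n = (LEAST n. \<not> independent_upto e (Suc n))"
  have dep: "\<not> independent_upto e (Suc n)"
    unfolding n_def by (rule LeastI_ex) fact
  have "independent_upto e (Suc 0)"
    using e0 unfolding independent_upto_def by simp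
  with dep have n0: "0 < n"
    by (cases n) auto
  have ind: "independent_upto e n"
    using not_less_Least[of "n - 1" "\<lambda>n. \<not> independent_upto e (Suc n)"] n0
    unfolding n_def[symmetric] by simp
  obtain c where "(\<Sum>i\<le>n. c i *\<^sub>R e i) = 0" "\<exists>i\<le>n. c i \<noteq> 0"
    using dep unfolding independent_upto_def lessThan_Suc_atMost less_Suc_eq_le by blast
  then obtain z where z: "\<forall>i\<le>n. z i \<in> \<int>" "\<exists>i\<le>n. z i \<noteq> 0" "(\<Sum>i\<le>n. z i *\<^sub>R e i) = 0"
    using int_vec_integer_relation[of "{..n}" e c] e_int by auto
  have "z n \<noteq> 0"
  proof
    assume "z n = 0"
    then have "(\<Sum>i<n. z i *\<^sub>R e i) = 0"
      using z(3) by (simp add: lessThan_Suc_atMost[symmetric])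
    then show False
      using ind z(2) \<open>z n = 0\<close> unfolding independent_upto_def by (metis le_neq_implies_less)
  qed
  with n0 ind z show thesis
    using that by blast
qed

section \<open>Iterates and cyclic subspaces\<close>

lemma funpow_preserves: "(\<And>x. P x \<Longrightarrow> P (f x)) \<Longrightarrow> P x \<Longrightarrow> P ((f ^^ n) x)"
  by (induction n) auto

lemma linear_funpow:
  fixes f :: "'a::real_vector \<Rightarrow> 'a"
  assumes "linear f"
  shows "linear (f ^^ n)"
proof (induction n)
  case 0
  show ?case
    by (simp add: linear_iff)
next
  case (Suc n)
  then show ?case
    using linear_compose[OF Suc assms] by (simp only: funpow.simps(2))
qed

lemma funpow_left_inverse:
  fixes f g :: "'a \<Rightarrow> 'a"
  assumes "\<And>x. g (f x) = x"
  shows "(g ^^ n) ((f ^^ n) x) = x"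
proof (induction n)
  case (Suc n)
  have "(g ^^ Suc n) ((f ^^ Suc n) x) = (g ^^ n) (g (f ((f ^^ n) x)))"
    by (simp only: funpow_Suc_right[of n g] funpow.simps(2)[of n f] o_apply)
  then show ?case
    using Suc assms by simp
qed simp

lemma relation_solve_last:
  fixes f :: "nat \<Rightarrow> 'a::real_vector"
  assumes "z n \<noteq> 0" "(\<Sum>i\<le>n. z i *\<^sub>R f i) = 0"
  shows "f n = (\<Sum>i<n. (- z i / z n) *\<^sub>R f i)"
proof -
  have "z n *\<^sub>R f n = - (\<Sum>i<n. z i *\<^sub>R f i)"
    using assms(2) by (simp add: lessThan_Suc_atMost[symmetric] eq_neg_iff_add_eq_0 add.commute)
  then have "f n = (1 / z n) *\<^sub>R - (\<Sum>i<n. z i *\<^sub>R f i)"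
    using assms(1) by (metis eq_vector_fraction_iff scaleR_one)
  then show ?thesis
    by (simp add: scaleR_sum_right sum_negf)
qed

lemma linear_inj_on_subspace_image_eq:
  fixes f :: "'a::euclidean_space \<Rightarrow> 'a"
  assumes "linear f" "subspace V" "f ` V \<subseteq> V" "inj_on f V"
  shows "f ` V = V"
proof -
  have "dim (f ` V) = dim V"
    using assms by (metis dim_image_eq span_eq_iff)
  then show ?thesis
    using assms by (intro subspace_dim_equal linear_subspace_image) auto
qed

text \<open>The backward statement holds because g maps W onto itself.\<close>
lemma commuting_on_invariant_subspace_orbits:
  fixes g g' T :: "'a::euclidean_space \<Rightarrow> 'a"
  assumes g: "linear g" and g'g: "\<And>x. g' (g x) = x"
    and W: "subspace W" "g ` W \<subseteq> W" "k \<in> W"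
    and comm: "\<And>x. x \<in> W \<Longrightarrow> T (g x) = g (T x)"
  shows "T ((g ^^ j) k) = (g ^^ j) (T k)" "T ((g' ^^ j) k) = (g' ^^ j) (T k)"
proof -
  have "(g ^^ j) k \<in> W \<and> T ((g ^^ j) k) = (g ^^ j) (T k)"
    by (induction j) (use W comm in auto)
  then show "T ((g ^^ j) k) = (g ^^ j) (T k)" ..
  have onto: "g ` W = W"
    using g W by (intro linear_inj_on_subspace_image_eq) (auto intro: inj_on_inverseI[of W g'] g'g)
  have inverse_step: "g' y \<in> W \<and> T (g' y) = g' (T y)" if "y \<in> W" for y
  proof -
    obtain x where "x \<in> W" "y = g x"
      using onto \<open>y \<in> W\<close> by blast
    then show ?thesis
      using comm g'g by simp
  qed
  have "(g' ^^ j) k \<in> W \<and> T ((g' ^^ j) k) = (g' ^^ j) (T k)"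
    by (induction j) (use W inverse_step in auto)
  then show "T ((g' ^^ j) k) = (g' ^^ j) (T k)" ..
qed

lemma cyclic_span_invariant:
  fixes g :: "'a::euclidean_space \<Rightarrow> 'a"
  assumes g: "linear g" and "z n \<noteq> 0" "(\<Sum>i\<le>n. z i *\<^sub>R (g ^^ i) k) = 0"
  shows "g ` span ((\<lambda>i. (g ^^ i) k) ` {..<n}) \<subseteq> span ((\<lambda>i. (g ^^ i) k) ` {..<n})"
proof -
  let ?W = "span ((\<lambda>i. (g ^^ i) k) ` {..<n})"
  have last: "(g ^^ n) k = (\<Sum>i<n. (- z i / z n) *\<^sub>R (g ^^ i) k)"
    using relation_solve_last[of z n "\<lambda>i. (g ^^ i) k"] assms(2,3) by simp
  have "(g ^^ n) k \<in> ?W"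
    unfolding last by (intro span_sum span_scale span_base) auto
  have "g ((g ^^ i) k) \<in> ?W" if "i < n" for i
  proof (cases "Suc i = n")
    case True
    then show ?thesis
      using \<open>(g ^^ n) k \<in> ?W\<close> by auto
  next
    case False
    with that have "g ((g ^^ i) k) \<in> (\<lambda>i. (g ^^ i) k) ` {..<n}"
      by (intro image_eqI[of _ _ "Suc i"]) auto
    then show ?thesis
      by (rule span_base)
  qed
  then have "g ` (\<lambda>i. (g ^^ i) k) ` {..<n} \<subseteq> ?W"
    by blast
  then show ?thesis
    unfolding span_linear_image[OF g, symmetric] by (simp add: span_minimal)
qed

lemma cyclic_span_intertwiner:
  fixes g :: "'a::euclidean_space \<Rightarrow> 'a"
  assumes g: "linear g" and ind: "independent_upto (\<lambda>i. (g ^^ i) k) n" and n: "0 < n"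
    and zn: "z n \<noteq> 0"
    and rel_k: "(\<Sum>i\<le>n. z i *\<^sub>R (g ^^ i) k) = 0" and rel_s: "(\<Sum>i\<le>n. z i *\<^sub>R (g ^^ i) s) = 0"
  obtains T W where "linear T" "T k = s" "subspace W" "g ` W \<subseteq> W" "k \<in> W"
    "\<And>x. x \<in> W \<Longrightarrow> T (g x) = g (T x)"
proof -
  define e where "e = (\<lambda>i. (g ^^ i) k)"
  define e' where "e' = (\<lambda>i. (g ^^ i) s)"
  have indep: "independent (e ` {..<n})" and inj: "inj_on e {..<n}"
    using independent_upto_independent independent_upto_inj_on ind unfolding e_def by blast+
  define T where "T = construct (e ` {..<n}) (\<lambda>x. e' (inv_into {..<n} e x))"
  have T: "linear T"
    unfolding T_def by (rule linear_construct[OF indep])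
  have Te: "T (e i) = e' i" if "i < n" for i
    unfolding T_def using construct_basis[OF indep, of "e i" "\<lambda>x. e' (inv_into {..<n} e x)"]
      inv_into_f_f[OF inj] that by simp
  have "e n = (\<Sum>i<n. (- z i / z n) *\<^sub>R e i)" "e' n = (\<Sum>i<n. (- z i / z n) *\<^sub>R e' i)"
    using relation_solve_last[of z n e, OF zn] relation_solve_last[of z n e', OF zn] rel_k rel_s
    unfolding e_def e'_def by simp_all
  then have Te_n: "T (e n) = e' n"
    by (simp add: linear_sum[OF T] linear_scale[OF T] linear_neg[OF T] Te)
  have "T (g (e i)) = g (T (e i))" if "i < n" for i
  proof -
    have "g (e i) = e (Suc i)" "g (e' i) = e' (Suc i)"
      unfolding e_def e'_def by simp_all
    then show ?thesis
      using that Te Te_n by (cases "Suc i = n") auto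
  qed
  then have comm: "T (g x) = g (T x)" if "x \<in> span (e ` {..<n})" for x
    using linear_eq_on_span[of "T \<circ> g" "g \<circ> T" "e ` {..<n}"] T g that
    by (auto intro: linear_compose)
  have "k \<in> e ` {..<n}"
    unfolding e_def using n by (intro image_eqI[of _ _ 0]) auto
  then have "k \<in> span (e ` {..<n})"
    by (rule span_base)
  moreover have "T k = s"
    using Te[OF n] unfolding e_def e'_def by simp
  moreover have "g ` span (e ` {..<n}) \<subseteq> span (e ` {..<n})"
    using cyclic_span_invariant[OF g zn rel_k] unfolding e_def .
  ultimately show thesis
    using T comm by (intro that[of T "span (e ` {..<n})"]) auto
qed

section \<open>Growth along orbits\<close>

lemma matrix_inv_mult:
  fixes A :: "real^'n^'n"
  assumes "invertible A"
  shows "matrix_inv A ** A = mat 1" "A ** matrix_inv A = mat 1"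
proof -
  have "A ** matrix_inv A = mat 1 \<and> matrix_inv A ** A = mat 1"
    using assms unfolding invertible_def matrix_inv_def by (rule someI_ex)
  then show "matrix_inv A ** A = mat 1" "A ** matrix_inv A = mat 1"
    by auto
qed

lemma matrix_inv_cancel:
  fixes A :: "real^'n^'n"
  assumes "invertible A"
  shows "matrix_inv A *v (A *v x) = x" "A *v (matrix_inv A *v x) = x"
  by (simp_all add: matrix_vector_mul_assoc matrix_inv_mult[OF assms])

lemma invertible_norm_pos:
  fixes P :: "real^'n^'n"
  assumes "invertible P" "x \<noteq> 0"
  shows "0 < norm (P *v x)"
proof -
  have "P *v x \<noteq> 0"
    using matrix_inv_cancel(1)[OF assms(1), of x] assms(2) by auto
  then show ?thesis
    by simp
qed

lemma linear_bounded_invertible_norm: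
  fixes T :: "real^'n \<Rightarrow> real^'n" and P :: "real^'n^'n"
  assumes "linear T" "invertible P"
  obtains B where "0 \<le> B" "\<And>x. norm (P *v T x) \<le> B * norm (P *v x)"
proof -
  have "linear ((*v) P \<circ> T \<circ> (*v) (matrix_inv P))"
    using assms(1) by (intro linear_compose matrix_vector_mul_linear)
  then have "linear (\<lambda>y. P *v T (matrix_inv P *v y))"
    by (simp add: o_def)
  then obtain B where "0 < B" "\<And>y. norm (P *v T (matrix_inv P *v y)) \<le> norm y * B"
    using linear_conv_bounded_linear bounded_linear.pos_bounded by blast
  then show thesis
    using that[of B] matrix_inv_cancel(1)[OF assms(2)] by (metis less_imp_le mult.commute)
qed

lemma not_all_power_le:
  fixes \<alpha> \<beta> A B :: real
  assumes "0 \<le> \<beta>" "\<beta> < \<alpha>" "0 < A"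
  shows "\<not> (\<forall>j. A * \<alpha> ^ j \<le> B * \<beta> ^ j)"
proof
  assume le: "\<forall>j. A * \<alpha> ^ j \<le> B * \<beta> ^ j"
  show False
  proof (cases "\<beta> = 0")
    case True
    then show False
      using le[rule_format, of 1] assms by (simp add: mult_le_0_iff)
  next
    case False
    then have "1 < \<alpha> / \<beta>" "0 < \<beta>"
      using assms by simp_all
    then obtain j where "B / A < (\<alpha> / \<beta>) ^ j"
      using real_arch_pow by blast
    then have "B * \<beta> ^ j < A * \<alpha> ^ j"
      using assms(3) \<open>0 < \<beta>\<close> by (simp add: field_simps)
    then show False
      using le by (meson not_le)
  qed
qed

lemma funpow_weighted_le:
  fixes N :: "'a \<Rightarrow> real"
  assumes "\<And>v. v \<in> X \<Longrightarrow> g v \<in> X" "\<And>v. v \<in> X \<Longrightarrow> a * N (g v) \<le> b * N v"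
    and "0 \<le> a" "0 \<le> b" "v \<in> X"
  shows "a ^ j * N ((g ^^ j) v) \<le> b ^ j * N v"
proof (induction j)
  case (Suc j)
  have "(g ^^ j) v \<in> X"
    using assms(1,5) by (rule funpow_preserves[where P = "\<lambda>v. v \<in> X"])
  have "a ^ Suc j * N ((g ^^ Suc j) v) = a ^ j * (a * N (g ((g ^^ j) v)))"
    by (simp add: ac_simps)
  also have "\<dots> \<le> a ^ j * (b * N ((g ^^ j) v))"
    using assms(2)[OF \<open>(g ^^ j) v \<in> X\<close>] assms(3) by (simp add: mult_left_mono)
  also have "\<dots> \<le> b ^ Suc j * N v"
    using mult_left_mono[OF Suc.IH assms(4)] by (simp add: ac_simps)
  finally show ?case .
qed simp

lemma funpow_weighted_ge:
  fixes N :: "'a \<Rightarrow> real"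
  assumes "\<And>v. v \<in> X \<Longrightarrow> g v \<in> X" "\<And>v. v \<in> X \<Longrightarrow> a * N v \<le> b * N (g v)"
    and "0 \<le> a" "0 \<le> b" "v \<in> X"
  shows "a ^ j * N v \<le> b ^ j * N ((g ^^ j) v)"
proof -
  have "b ^ j * - N ((g ^^ j) v) \<le> a ^ j * - N v"
    using assms by (intro funpow_weighted_le[of X g b "\<lambda>v. - N v" a]) auto
  then show ?thesis
    by simp
qed

text \<open>Read a / b as the growth rate of the orbit of s and d / c as that of k.\<close>
lemma dominated_orbit_rates:
  fixes N :: "'a \<Rightarrow> real"
  assumes s: "\<And>j. a ^ j * N s \<le> b ^ j * N ((g ^^ j) s)"
    and dom: "\<And>j. N ((g ^^ j) s) \<le> B * N ((g ^^ j) k)"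
    and k: "\<And>j. c ^ j * N ((g ^^ j) k) \<le> d ^ j * N k"
    and "0 \<le> b" "0 \<le> c" "0 \<le> d" "0 \<le> B" "0 < N s"
  shows "a * c \<le> b * d"
proof (rule ccontr)
  assume "\<not> a * c \<le> b * d"
  moreover have "N s * (a * c) ^ j \<le> (B * N k) * (b * d) ^ j" for j
  proof -
    have "N s * (a * c) ^ j = c ^ j * (a ^ j * N s)"
      by (simp add: power_mult_distrib)
    also have "\<dots> \<le> c ^ j * (b ^ j * (B * N ((g ^^ j) k)))"
      using order_trans[OF s[of j] mult_left_mono[OF dom[of j]]] assms(4,5)
      by (simp add: mult_left_mono)
    also have "\<dots> = b ^ j * B * (c ^ j * N ((g ^^ j) k))"
      by (simp add: ac_simps)
    also have "\<dots> \<le> b ^ j * B * (d ^ j * N k)"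
      using k[of j] assms(4,7) by (simp add: mult_left_mono)
    also have "\<dots> = (B * N k) * (b * d) ^ j"
      by (simp add: power_mult_distrib ac_simps)
    finally show ?thesis .
  qed
  ultimately show False
    using not_all_power_le[of "b * d" "a * c" "N s" "B * N k"] assms(4,6,8) by auto
qed

section \<open>Leaves and holonomies of integer automorphisms\<close>

lemma SL_int_invertible: "SL_int F \<Longrightarrow> invertible F"
  unfolding SL_int_def by (simp add: invertible_det_nz)

lemma SL_int_int_vec: "SL_int F \<Longrightarrow> int_vec x \<Longrightarrow> int_vec (F *v x)"
  unfolding SL_int_def by (simp add: int_vec_matrix_vector_mult)

lemma det_Ints: "(\<And>i j. A $ i $ j \<in> \<int>) \<Longrightarrow> det (A::real^'n^'n) \<in> \<int>"
  unfolding det_def by (intro Ints_sum Ints_mult Ints_prod) auto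

text \<open>Cramer's rule: the coordinates of the preimage are integer determinants divided by
  the determinant 1.\<close>
lemma SL_int_inv_int_vec:
  fixes F :: "real^'n^'n"
  assumes F: "SL_int F" and b: "int_vec b"
  shows "int_vec (matrix_inv F *v b)"
  unfolding int_vec_def
proof
  fix k
  define x where "x = matrix_inv F *v b"
  have "det ((\<chi> i j. if j = k then (F *v x) $ i else F $ i $ j) :: real^'n^'n) = x $ k * det F"
    by (rule cramer_lemma)
  then have "x $ k = det ((\<chi> i j. if j = k then (F *v x) $ i else F $ i $ j) :: real^'n^'n)"
    using F unfolding SL_int_def by simp
  also have "\<dots> \<in> \<int>"
    using F b matrix_inv_cancel(2)[OF SL_int_invertible[OF F]]
    unfolding x_def SL_int_def int_vec_def by (intro det_Ints) simp
  finally show "x $ k \<in> \<int>" .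
qed

lemma invertible_inv_image_mem:
  fixes F :: "real^'n^'n"
  assumes "invertible F" "(*v) F ` V = V" "v \<in> V"
  shows "matrix_inv F *v v \<in> V"
proof -
  obtain w where "w \<in> V" "v = F *v w"
    using assms(2,3) by blast
  then show ?thesis
    using matrix_inv_cancel(1)[OF assms(1)] by simp
qed

lemma Fpow_preserves:
  assumes "\<And>x. P x \<Longrightarrow> P (F *v x)" "\<And>x. P x \<Longrightarrow> P (matrix_inv F *v x)" "P x"
  shows "P (Fpow F n x)"
  unfolding Fpow_def using assms by (simp add: funpow_preserves)

lemma linear_Fpow: "linear (Fpow F n)"
proof (cases "0 \<le> n")
  case True
  then have "Fpow F n = (*v) F ^^ nat n"
    by (simp add: Fpow_def fun_eq_iff)
  then show ?thesis
    by (simp add: linear_funpow)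
next
  case False
  then have "Fpow F n = (*v) (matrix_inv F) ^^ nat (- n)"
    by (simp add: Fpow_def fun_eq_iff)
  then show ?thesis
    by (simp add: linear_funpow)
qed

lemma Wuu_eq_Wss: "Wuu = Wss"
  by (simp add: fun_eq_iff Wuu_def Wss_def)

lemma Fpow_Wss:
  fixes F :: "real^'n^'n"
  assumes F: "SL_int F" and V: "(*v) F ` V = V" and y: "y \<in> Wss V x"
  shows "Fpow F n y \<in> Wss V (Fpow F n x)"
proof -
  obtain v where v: "v \<in> V" "int_vec (y - x - v)"
    using y unfolding Wss_def by blast
  have "Fpow F n v \<in> V"
    using V v(1) invertible_inv_image_mem[OF SL_int_invertible[OF F] V]
    by (intro Fpow_preserves[where P = "\<lambda>x. x \<in> V"]) blast+
  moreover have "int_vec (Fpow F n (y - x - v))"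
    using SL_int_int_vec[OF F] SL_int_inv_int_vec[OF F] v(2) by (rule Fpow_preserves[where P = int_vec])
  then have "int_vec (Fpow F n y - Fpow F n x - Fpow F n v)"
    by (simp add: linear_diff[OF linear_Fpow])
  ultimately show ?thesis
    unfolding Wss_def by blast
qed

lemma torus_fun_Wss_eq:
  assumes "torus_fun \<phi>" "\<And>x w. w \<in> V \<Longrightarrow> \<phi> (x + w) = \<phi> x" "y \<in> Wss V x"
  shows "\<phi> y = \<phi> x"
proof -
  obtain v where "v \<in> V" "int_vec (y - x - v)"
    using assms(3) unfolding Wss_def by blast
  have "\<phi> y = \<phi> ((x + v) + (y - x - v))"
    by simp
  also have "\<dots> = \<phi> (x + v)"
    using assms(1) \<open>int_vec (y - x - v)\<close> unfolding torus_fun_def by blast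
  also have "\<dots> = \<phi> x"
    using assms(2) \<open>v \<in> V\<close> .
  finally show ?thesis .
qed

lemma Hol_s_Wss_eq_0:
  fixes F :: "real^'n^'n"
  assumes "SL_int F" "(*v) F ` V = V" "torus_fun \<phi>" "\<And>x w. w \<in> V \<Longrightarrow> \<phi> (x + w) = \<phi> x"
    and "y \<in> Wss V x"
  shows "Hol_s F x y \<phi> = 0"
proof -
  have "\<phi> (Fpow F m y) = \<phi> (Fpow F m x)" for m
    by (rule torus_fun_Wss_eq[of \<phi> V, OF assms(3,4) Fpow_Wss[OF assms(1,2,5)]])
  then show ?thesis
    by (simp add: Hol_s_def)
qed

lemma Hol_u_Wuu_eq_0:
  fixes F :: "real^'n^'n"
  assumes "SL_int F" "(*v) F ` V = V" "torus_fun \<phi>" "\<And>x w. w \<in> V \<Longrightarrow> \<phi> (x + w) = \<phi> x"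
    and "y \<in> Wuu V x"
  shows "Hol_u F x y \<phi> = 0"
proof -
  have "\<phi> (Fpow F m y) = \<phi> (Fpow F m x)" for m
    by (rule torus_fun_Wss_eq[of \<phi> V, OF assms(3,4) Fpow_Wss[OF assms(1,2) assms(5)[unfolded Wuu_eq_Wss]]])
  then show ?thesis
    by (simp add: Hol_u_def)
qed

lemma PCF_eq_0:
  assumes "\<And>x y. y \<in> Wss S x \<Longrightarrow> Hol_s F x y \<phi> = 0" "\<And>x y. y \<in> Wuu U x \<Longrightarrow> Hol_u F x y \<phi> = 0"
    and "su_cycle S U x0 legs"
  shows "PCF F x0 legs \<phi> = 0"
  unfolding PCF_def
proof (rule sum.neutral, rule ballI)
  fix j
  assume "j \<in> {..<length legs}"
  define prev where "prev = (if j = 0 then x0 else fst (legs ! (j - 1)))"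
  obtain y b where yb: "legs ! j = (y, b)"
    by fastforce
  have "let prev = (if j = 0 then x0 else fst (legs ! (j - 1))); (y, b) = legs ! j in
      if b then y \<in> Wss S prev else y \<in> Wuu U prev"
    using assms(3) \<open>j \<in> {..<length legs}\<close> unfolding su_cycle_def by blast
  then have "if b then y \<in> Wss S prev else y \<in> Wuu U prev"
    unfolding prev_def Let_def yb by simp
  then show "(let prev = (if j = 0 then x0 else fst (legs ! (j - 1))); (y, b) = legs ! j in
      if b then Hol_s F prev y \<phi> else Hol_u F prev y \<phi>) = 0"
    using assms(1,2) unfolding prev_def Let_def yb by (cases b) simp_all
qed

section \<open>Fourier modes and periodic orbits\<close>

definition fourier_cos :: "real^'n \<Rightarrow> real^'n \<Rightarrow> real" where
  "fourier_cos m x = cos (2 * pi * (m \<bullet> x))"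

lemma has_derivative_cos_sin_mode:
  "((\<lambda>x::real^'n. A * cos (2 * pi * (m \<bullet> x)) + B * sin (2 * pi * (m \<bullet> x))) has_derivative
     (\<lambda>h. (B * cos (2 * pi * (m \<bullet> x)) - A * sin (2 * pi * (m \<bullet> x))) * (2 * pi * (m \<bullet> h)))) (at x)"
  by (auto intro!: derivative_eq_intros simp: algebra_simps)

lemma iter_dderiv_fourier_cos:
  "\<exists>A B. iter_dderiv vs (fourier_cos m) =
    (\<lambda>x. A * cos (2 * pi * (m \<bullet> x)) + B * sin (2 * pi * (m \<bullet> x)))"
proof (induction vs)
  case Nil
  show ?case
    by (intro exI[of _ 1] exI[of _ 0]) (simp add: fourier_cos_def fun_eq_iff)
next
  case (Cons v vs)
  then obtain A B where AB: "iter_dderiv vs (fourier_cos m) =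
      (\<lambda>x. A * cos (2 * pi * (m \<bullet> x)) + B * sin (2 * pi * (m \<bullet> x)))"
    by blast
  have "iter_dderiv (v # vs) (fourier_cos m) x =
      frechet_derivative (\<lambda>x. A * cos (2 * pi * (m \<bullet> x)) + B * sin (2 * pi * (m \<bullet> x))) (at x) v"
    for x
    by (simp add: AB)
  also have "\<dots> x = (B * cos (2 * pi * (m \<bullet> x)) - A * sin (2 * pi * (m \<bullet> x))) * (2 * pi * (m \<bullet> v))"
    for x
    using frechet_derivative_at[OF has_derivative_cos_sin_mode[of A m B x]] by metis
  finally have "iter_dderiv (v # vs) (fourier_cos m) =
      (\<lambda>x. (B * (2 * pi * (m \<bullet> v))) * cos (2 * pi * (m \<bullet> x))
        + (- A * (2 * pi * (m \<bullet> v))) * sin (2 * pi * (m \<bullet> x)))"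
    by (simp add: fun_eq_iff algebra_simps)
  then show ?case
    by blast
qed

lemma smooth_fourier_cos: "smooth_fun (fourier_cos m)"
  unfolding smooth_fun_def
proof (intro allI)
  fix vs x
  obtain A B where AB: "iter_dderiv vs (fourier_cos m) =
      (\<lambda>x. A * cos (2 * pi * (m \<bullet> x)) + B * sin (2 * pi * (m \<bullet> x)))"
    using iter_dderiv_fourier_cos by blast
  show "iter_dderiv vs (fourier_cos m) differentiable at x"
    unfolding AB using has_derivative_cos_sin_mode by (rule differentiableI)
qed

lemma cos_2pi_add_Ints: "t \<in> \<int> \<Longrightarrow> cos (2 * pi * (a + t)) = cos (2 * pi * a)"
  by (simp add: distrib_left cos_add cos_integer_2pi sin_integer_2pi)

lemma torus_fun_fourier_cos: "int_vec m \<Longrightarrow> torus_fun (fourier_cos m)"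
  unfolding torus_fun_def fourier_cos_def by (auto simp: inner_add_right cos_2pi_add_Ints int_vec_inner)

lemma fourier_cos_add_orthogonal: "m \<bullet> w = 0 \<Longrightarrow> fourier_cos m (x + w) = fourier_cos m x"
  by (simp add: fourier_cos_def inner_add_right)

lemma PCF_fourier_cos_eq_0:
  fixes F :: "real^'n^'n"
  assumes F: "SL_int F" and S: "(*v) F ` S = S" and U: "(*v) F ` U = U"
    and m: "int_vec m" "\<And>w. w \<in> S \<union> U \<Longrightarrow> m \<bullet> w = 0"
    and "su_cycle S U x0 legs"
  shows "PCF F x0 legs (fourier_cos m) = 0"
proof (rule PCF_eq_0[OF _ _ assms(6)])
  show "Hol_s F x y (fourier_cos m) = 0" if "y \<in> Wss S x" for x y
    by (rule Hol_s_Wss_eq_0[OF F S torus_fun_fourier_cos[OF m(1)] _ that])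
      (simp add: fourier_cos_add_orthogonal m(2))
  show "Hol_u F x y (fourier_cos m) = 0" if "y \<in> Wuu U x" for x y
    by (rule Hol_u_Wuu_eq_0[OF F U torus_fun_fourier_cos[OF m(1)] _ that])
      (simp add: fourier_cos_add_orthogonal m(2))
qed

text \<open>Pigeonhole on the residues modulo M of the coordinates.\<close>
lemma int_vec_seq_congruent:
  fixes e :: "nat \<Rightarrow> real^'n"
  assumes e_int: "\<And>i. int_vec (e i)" and M: "M \<noteq> (0::int)"
  obtains a b where "a < b" "int_vec ((1 / M) *\<^sub>R (e b - e a))"
proof -
  define r where "r i = (\<lambda>l. \<lfloor>e i $ l\<rfloor> mod M)" for i
  have "k mod M \<in> {-\<bar>M\<bar>..\<bar>M\<bar>}" for k
    using abs_mod_less[OF M, of k] by (auto simp: abs_less_iff)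
  then have "range r \<subseteq> Pi UNIV (\<lambda>_. {-\<bar>M\<bar>..\<bar>M\<bar>})"
    unfolding r_def by blast
  moreover have "finite (Pi UNIV (\<lambda>_::'n. {-\<bar>M\<bar>..\<bar>M\<bar>}))"
    using finite_PiE[of UNIV "\<lambda>_::'n. {-\<bar>M\<bar>..\<bar>M\<bar>}"] by (simp add: PiE_UNIV_domain)
  ultimately have "\<not> inj r"
    using inj_on_finite infinite_UNIV_nat by blast
  then obtain a b where "a < b" "r a = r b"
    unfolding inj_def by (metis linorder_neqE_nat)
  have "((1 / M) *\<^sub>R (e b - e a)) $ l \<in> \<int>" for l
  proof -
    have "M dvd \<lfloor>e b $ l\<rfloor> - \<lfloor>e a $ l\<rfloor>"
      using fun_cong[OF \<open>r a = r b\<close>, of l] unfolding r_def by (metis mod_eq_dvd_iff)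
    then obtain t where "\<lfloor>e b $ l\<rfloor> - \<lfloor>e a $ l\<rfloor> = M * t"
      by blast
    moreover have "of_int \<lfloor>e a $ l\<rfloor> = e a $ l" "of_int \<lfloor>e b $ l\<rfloor> = e b $ l"
      using e_int[of a] e_int[of b] unfolding int_vec_def by (metis Ints_cases floor_of_int)+
    ultimately have "e b $ l - e a $ l = of_int M * of_int t"
      by (metis of_int_diff of_int_mult)
    then show ?thesis
      using M by simp
  qed
  then show thesis
    using that \<open>a < b\<close> unfolding int_vec_def by blast
qed

lemma rational_point_periodic:
  fixes F :: "real^'n^'n"
  assumes F: "SL_int F" and v: "int_vec v" and M: "M \<noteq> (0::int)"
  obtains p where "0 < p" "int_vec (((*v) F ^^ p) ((1 / M) *\<^sub>R v) - (1 / M) *\<^sub>R v)"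
proof -
  define e where "e i = ((*v) F ^^ i) v" for i
  have "int_vec (e i)" for i
    unfolding e_def using SL_int_int_vec[OF F] v by (rule funpow_preserves[where P = int_vec])
  then obtain a b where "a < b" "int_vec ((1 / M) *\<^sub>R (e b - e a))"
    using int_vec_seq_congruent M by blast
  then have "int_vec (((*v) (matrix_inv F) ^^ a) ((1 / M) *\<^sub>R (e b - e a)))"
    using SL_int_inv_int_vec[OF F] by (intro funpow_preserves[where P = int_vec]) auto
  moreover have "((*v) (matrix_inv F) ^^ a) ((1 / M) *\<^sub>R (e b - e a))
      = ((*v) F ^^ (b - a)) ((1 / M) *\<^sub>R v) - (1 / M) *\<^sub>R v"
  proof -
    have inv: "matrix_inv F *v (F *v x) = x" for x
      using matrix_inv_cancel(1)[OF SL_int_invertible[OF F]] .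
    have "e b = ((*v) F ^^ a) (((*v) F ^^ (b - a)) v)"
      unfolding e_def using \<open>a < b\<close> by (metis funpow_add le_add_diff_inverse less_imp_le o_apply)
    then have "((*v) (matrix_inv F) ^^ a) (e b) = ((*v) F ^^ (b - a)) v"
      "((*v) (matrix_inv F) ^^ a) (e a) = v"
      using funpow_left_inverse[of "(*v) (matrix_inv F)" "(*v) F", OF inv] unfolding e_def by simp_all
    then show ?thesis
      using linear_funpow[OF matrix_vector_mul_linear[of "matrix_inv F"], of a]
        linear_funpow[OF matrix_vector_mul_linear[of F], of "b - a"]
      by (simp add: linear_scale linear_diff scaleR_diff_right)
  qed
  ultimately show thesis
    using that[of "b - a"] \<open>a < b\<close> by simp
qed

lemma coboundary_periodic_sum:
  fixes g :: "real^'n \<Rightarrow> real^'n" and u \<phi> :: "real^'n \<Rightarrow> real"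
  assumes u: "torus_fun u" and cob: "\<And>x. \<phi> x = u (g x) - u x + K"
    and per: "int_vec ((g ^^ p) x - x)"
  shows "(\<Sum>i<p. \<phi> ((g ^^ i) x)) = p * K"
proof -
  have "(\<Sum>i<p. \<phi> ((g ^^ i) x)) = (\<Sum>i<p. u ((g ^^ Suc i) x) - u ((g ^^ i) x)) + p * K"
    by (simp add: cob sum.distrib)
  also have "(\<Sum>i<p. u ((g ^^ Suc i) x) - u ((g ^^ i) x)) = u ((g ^^ p) x) - u x"
    using sum_lessThan_telescope[of "\<lambda>i. u ((g ^^ i) x)" p] by simp
  also have "u ((g ^^ p) x) = u (x + ((g ^^ p) x - x))"
    by simp
  also have "\<dots> = u x"
    using u per unfolding torus_fun_def by blast
  finally show ?thesis
    by simp
qed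

lemma fourier_cos_not_coboundary:
  fixes F :: "real^'n^'n"
  assumes F: "SL_int F" and m: "int_vec m" "m \<noteq> 0" and u: "torus_fun u"
  shows "\<not> (\<forall>x. fourier_cos m x = u (F *v x) - u x + K)"
proof
  assume cob: "\<forall>x. fourier_cos m x = u (F *v x) - u x + K"
  then have "fourier_cos m 0 = u (F *v 0) - u 0 + K"
    by blast
  then have "K = 1"
    by (simp add: fourier_cos_def)
  obtain j where "m $ j \<noteq> 0"
    using ex_nonzero_component[OF m(2)] by blast
  moreover obtain z :: int where z: "m $ j = of_int z"
    using m(1) unfolding int_vec_def by (metis Ints_cases)
  ultimately have z0: "2 * z \<noteq> 0"
    by auto
  define x0 where "x0 = (1 / of_int (2 * z)) *\<^sub>R (axis j 1 :: real^'n)"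
  have "fourier_cos m x0 = -1"
    using z z0 by (simp add: x0_def fourier_cos_def inner_axis)
  obtain p where "0 < p" and per: "int_vec (((*v) F ^^ p) x0 - x0)"
    using rational_point_periodic[OF F int_vec_axis z0] unfolding x0_def by blast
  then obtain q where q: "p = Suc q"
    using gr0_implies_Suc by blast
  have "(\<Sum>i<p. fourier_cos m (((*v) F ^^ i) x0)) = p"
    using coboundary_periodic_sum[OF u, of "fourier_cos m" "(*v) F" K p x0] cob per \<open>K = 1\<close>
    by simp
  moreover have "(\<Sum>i<p. fourier_cos m (((*v) F ^^ i) x0)) \<le> -1 + q"
  proof -
    have "(\<Sum>i<p. fourier_cos m (((*v) F ^^ i) x0)) = -1 + (\<Sum>i<q. fourier_cos m (((*v) F ^^ Suc i) x0))"
      unfolding q sum.lessThan_Suc_shift using \<open>fourier_cos m x0 = -1\<close> by simp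
    also have "\<dots> \<le> -1 + (\<Sum>i<q. 1)"
      by (intro add_left_mono sum_mono) (simp add: fourier_cos_def)
    finally show ?thesis
      by simp
  qed
  ultimately show False
    using q by simp
qed

section \<open>Partially hyperbolic automorphisms\<close>

definition poly_matrix_apply :: "(nat \<Rightarrow> real) \<Rightarrow> nat \<Rightarrow> real^'n^'n \<Rightarrow> real^'n \<Rightarrow> real^'n" where
  "poly_matrix_apply z n F x = (\<Sum>i\<le>n. z i *\<^sub>R ((*v) F ^^ i) x)"

lemma linear_poly_matrix_apply: "linear (poly_matrix_apply z n F)"
  unfolding poly_matrix_apply_def
  by (intro linear_compose_sum ballI linear_compose[OF linear_funpow[OF matrix_vector_mul_linear]
      linear_scaleR, unfolded o_def])

lemma poly_matrix_apply_int_vec: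
  assumes "\<forall>i\<le>n. z i \<in> \<int>" "SL_int F" "int_vec x"
  shows "int_vec (poly_matrix_apply z n F x)"
  unfolding poly_matrix_apply_def using assms SL_int_int_vec[OF assms(2)]
  by (intro int_vec_sum int_vec_scaleR funpow_preserves[where P = int_vec]) auto

lemma poly_matrix_apply_subspace:
  assumes "subspace V" "(*v) F ` V \<subseteq> V" "x \<in> V"
  shows "poly_matrix_apply z n F x \<in> V"
  unfolding poly_matrix_apply_def using assms
  by (intro subspace_sum subspace_scale funpow_preserves[where P = "\<lambda>x. x \<in> V"]) auto

locale adapted_splitting =
  fixes F P :: "real^'n^'n" and S C U :: "(real^'n) set" and sS mC MC mU :: real
  assumes invertible_F: "invertible F" and invertible_P: "invertible P"
    and subspace_S: "subspace S" and subspace_C: "subspace C" and subspace_U: "subspace U"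
    and image_S: "(*v) F ` S = S" and image_C: "(*v) F ` C = C" and image_U: "(*v) F ` U = U"
    and rate_gap_S: "sS < mC" and rate_gap_U: "MC < mU"
    and contract_S: "\<And>v. v \<in> S \<Longrightarrow> norm (P *v (F *v v)) \<le> sS * norm (P *v v)"
    and expand_C: "\<And>v. v \<in> C \<Longrightarrow> mC * norm (P *v v) \<le> norm (P *v (F *v v))"
    and contract_C: "\<And>v. v \<in> C \<Longrightarrow> norm (P *v (F *v v)) \<le> MC * norm (P *v v)"
    and expand_U: "\<And>v. v \<in> U \<Longrightarrow> mU * norm (P *v v) \<le> norm (P *v (F *v v))"

lemma partially_hyperbolic_adapted_splitting:
  fixes F :: "real^'n^'n"
  assumes "SL_int F" "partially_hyperbolic F S C U"
  obtains P sS mC MC mU where "adapted_splitting F P S C U sS mC MC mU"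
proof -
  have "subspace S" "subspace C" "subspace U" "(*v) F ` S = S" "(*v) F ` C = C" "(*v) F ` U = U"
    using assms(2) unfolding partially_hyperbolic_def by simp_all
  moreover obtain P :: "real^'n^'n" and sS mC MC mU where "invertible P" "sS < mC" "MC < mU"
    "\<forall>v\<in>S. norm (P *v (F *v v)) \<le> sS * norm (P *v v)"
    "\<forall>v\<in>C. mC * norm (P *v v) \<le> norm (P *v (F *v v)) \<and> norm (P *v (F *v v)) \<le> MC * norm (P *v v)"
    "\<forall>v\<in>U. mU * norm (P *v v) \<le> norm (P *v (F *v v))"
    using assms(2) unfolding partially_hyperbolic_def Let_def by (elim conjE exE) simp
  ultimately show thesis
    using that[of P sS mC MC mU] SL_int_invertible[OF assms(1)] unfolding adapted_splitting_def by blast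
qed

context adapted_splitting
begin

lemma intertwined_unstable_zero:
  fixes T :: "real^'n \<Rightarrow> real^'n"
  assumes T: "linear T" and orbit: "\<And>j. T (((*v) F ^^ j) k) = ((*v) F ^^ j) s"
    and "k \<in> C" "s \<in> U"
  shows "s = 0"
proof (rule ccontr)
  assume "s \<noteq> 0"
  define N where "N v = norm (P *v v)" for v
  obtain B where B: "0 \<le> B" "\<And>x. N (T x) \<le> B * N x"
    using linear_bounded_invertible_norm[OF T invertible_P] unfolding N_def by blast
  have "k \<noteq> 0"
    using \<open>s \<noteq> 0\<close> orbit[of 0] linear_0[OF T] by auto
  then have "0 < norm (P *v k)"
    by (rule invertible_norm_pos[OF invertible_P])
  moreover have "0 \<le> MC * norm (P *v k)"
    using contract_C[OF \<open>k \<in> C\<close>] by (rule order_trans[OF norm_ge_zero])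
  ultimately have "0 \<le> MC"
    by (simp add: zero_le_mult_iff)
  have "mU * 1 \<le> 1 * MC"
  proof (rule dominated_orbit_rates[where g = "(*v) F" and N = N and B = B])
    show "mU ^ j * N s \<le> 1 ^ j * N (((*v) F ^^ j) s)" for j
      using image_U expand_U \<open>s \<in> U\<close> \<open>0 \<le> MC\<close> rate_gap_U unfolding N_def
      by (intro funpow_weighted_ge[where X = U]) auto
    show "N (((*v) F ^^ j) s) \<le> B * N (((*v) F ^^ j) k)" for j
      using B(2) orbit by metis
    show "1 ^ j * N (((*v) F ^^ j) k) \<le> MC ^ j * N k" for j
      using image_C contract_C \<open>k \<in> C\<close> \<open>0 \<le> MC\<close> unfolding N_def
      by (intro funpow_weighted_le[where X = C]) auto
    show "0 < N s"
      using invertible_norm_pos[OF invertible_P \<open>s \<noteq> 0\<close>] unfolding N_def .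
  qed (use B \<open>0 \<le> MC\<close> in auto)
  then show False
    using rate_gap_U by simp
qed

lemma intertwined_stable_zero:
  fixes T :: "real^'n \<Rightarrow> real^'n"
  assumes T: "linear T" and orbit: "\<And>j. T (((*v) (matrix_inv F) ^^ j) k) = ((*v) (matrix_inv F) ^^ j) s"
    and "k \<in> C" "s \<in> S"
  shows "s = 0"
proof (rule ccontr)
  assume "s \<noteq> 0"
  define N where "N v = norm (P *v v)" for v
  obtain B where B: "0 \<le> B" "\<And>x. N (T x) \<le> B * N x"
    using linear_bounded_invertible_norm[OF T invertible_P] unfolding N_def by blast
  have "0 < N s"
    using invertible_norm_pos[OF invertible_P \<open>s \<noteq> 0\<close>] unfolding N_def .
  moreover have "0 \<le> sS * N s"
    using contract_S[OF \<open>s \<in> S\<close>] unfolding N_def by (rule order_trans[OF norm_ge_zero])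
  ultimately have "0 \<le> sS"
    by (simp add: zero_le_mult_iff)
  have F_inv: "F *v (matrix_inv F *v v) = v" for v
    by (rule matrix_inv_cancel(2)[OF invertible_F])
  have S_step: "1 * N v \<le> sS * N (matrix_inv F *v v)" if "v \<in> S" for v
    using contract_S[OF invertible_inv_image_mem[OF invertible_F image_S that]] F_inv
    unfolding N_def by simp
  have C_step: "mC * N (matrix_inv F *v v) \<le> 1 * N v" if "v \<in> C" for v
    using expand_C[OF invertible_inv_image_mem[OF invertible_F image_C that]] F_inv
    unfolding N_def by simp
  have "1 * mC \<le> sS * 1"
  proof (rule dominated_orbit_rates[where g = "(*v) (matrix_inv F)" and N = N and B = B])
    show "1 ^ j * N s \<le> sS ^ j * N (((*v) (matrix_inv F) ^^ j) s)" for j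
      using invertible_inv_image_mem[OF invertible_F image_S] S_step \<open>s \<in> S\<close> \<open>0 \<le> sS\<close>
      by (intro funpow_weighted_ge[where X = S]) auto
    show "N (((*v) (matrix_inv F) ^^ j) s) \<le> B * N (((*v) (matrix_inv F) ^^ j) k)" for j
      using B(2) orbit by metis
    show "mC ^ j * N (((*v) (matrix_inv F) ^^ j) k) \<le> 1 ^ j * N k" for j
      using invertible_inv_image_mem[OF invertible_F image_C] C_step \<open>0 \<le> sS\<close> rate_gap_S \<open>k \<in> C\<close>
      by (intro funpow_weighted_le[where X = C]) auto
  qed (use B \<open>0 \<le> sS\<close> rate_gap_S \<open>0 < N s\<close> in auto)
  then show False
    using rate_gap_S by simp
qed

lemma poly_annihilated_zero:
  assumes "k \<in> C" and ind: "independent_upto (\<lambda>i. ((*v) F ^^ i) k) n" and "0 < n" "z n \<noteq> 0"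
    and "poly_matrix_apply z n F k = 0" "poly_matrix_apply z n F s = 0" and "s \<in> S \<union> U"
  shows "s = 0"
proof -
  obtain T W where T: "linear T" "T k = s" and W: "subspace W" "(*v) F ` W \<subseteq> W" "k \<in> W"
    and comm: "\<And>x. x \<in> W \<Longrightarrow> T (F *v x) = F *v T x"
    using cyclic_span_intertwiner[OF matrix_vector_mul_linear ind] assms(3-6)
    unfolding poly_matrix_apply_def by blast
  note orbits = commuting_on_invariant_subspace_orbits[of "(*v) F" "(*v) (matrix_inv F)" W k T,
      OF matrix_vector_mul_linear matrix_inv_cancel(1)[OF invertible_F] W comm]
  show "s = 0"
    using \<open>s \<in> S \<union> U\<close>
  proof
    assume "s \<in> S"
    then show "s = 0"
      using intertwined_stable_zero[OF T(1) _ \<open>k \<in> C\<close>] orbits(2) T(2) by metis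
  next
    assume "s \<in> U"
    then show "s = 0"
      using intertwined_unstable_zero[OF T(1) _ \<open>k \<in> C\<close>] orbits(1) T(2) by metis
  qed
qed

lemma integer_normal_to_stable_unstable:
  assumes F: "SL_int F" and k: "k \<in> C" "int_vec k" "k \<noteq> 0"
  obtains m where "int_vec m" "m \<noteq> 0" "\<And>w. w \<in> S \<union> U \<Longrightarrow> m \<bullet> w = 0"
proof -
  have "int_vec (((*v) F ^^ i) k)" for i
    using SL_int_int_vec[OF F] k(2) by (rule funpow_preserves[where P = int_vec])
  then obtain n z where nz: "0 < n" "independent_upto (\<lambda>i. ((*v) F ^^ i) k) n" "z n \<noteq> 0"
    "\<forall>i\<le>n. z i \<in> \<int>" "poly_matrix_apply z n F k = 0"
    using minimal_integer_relation[of "\<lambda>i. ((*v) F ^^ i) k"] k(3)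
    unfolding poly_matrix_apply_def by auto
  define Q where "Q = poly_matrix_apply z n F"
  have onto: "Q ` V = V" if "V = S \<or> V = U" for V
  proof (rule linear_inj_on_subspace_image_eq)
    show "linear Q"
      unfolding Q_def by (rule linear_poly_matrix_apply)
    show "subspace V"
      using that subspace_S subspace_U by auto
    show "Q ` V \<subseteq> V"
      using that poly_matrix_apply_subspace[OF subspace_S, of F] poly_matrix_apply_subspace[OF subspace_U, of F]
        image_S image_U unfolding Q_def by auto
    show "inj_on Q V"
      using that poly_annihilated_zero[OF k(1) nz(2,1,3,5)] subspace_S subspace_U
      unfolding Q_def by (auto simp: linear_inj_on_iff_eq_0[OF linear_poly_matrix_apply])
  qed
  have "\<not> inj Q"
    using nz(5) k(3) linear_0[OF linear_poly_matrix_apply] unfolding Q_def inj_def by metis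
  then obtain m where "int_vec m" "m \<noteq> 0" "\<And>y. m \<bullet> Q y = 0"
    using integer_left_kernel[OF linear_poly_matrix_apply _, of z n F] poly_matrix_apply_int_vec[OF nz(4) F]
    unfolding Q_def by metis
  then show thesis
    using that onto by (metis Un_iff imageE)
qed

end

theorem theorem3p2:
  fixes F :: "real^'n^'n" and S C U :: "(real^'n) set"
  assumes "SL_int F"
    and "partially_hyperbolic F S C U"
    and "\<forall>\<phi> :: real^'n \<Rightarrow> real. smooth_fun \<phi> \<and> torus_fun \<phi> \<and>
           (\<forall>x0 legs. su_cycle S U x0 legs \<longrightarrow> PCF F x0 legs \<phi> = 0) \<longrightarrow>
           (\<exists>u :: real^'n \<Rightarrow> real. \<exists>K :: real. torus_fun u \<and>
              (\<forall>x. \<phi> x = u (F *v x) - u x + K))"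
  shows "{k \<in> C. int_vec k} = {0}"
proof -
  obtain P sS mC MC mU where adapted: "adapted_splitting F P S C U sS mC MC mU"
    using partially_hyperbolic_adapted_splitting[OF assms(1,2)] .
  have "k = 0" if k: "k \<in> C" "int_vec k" for k
  proof (rule ccontr)
    assume "k \<noteq> 0"
    then obtain m where m: "int_vec m" "m \<noteq> 0" "\<And>w. w \<in> S \<union> U \<Longrightarrow> m \<bullet> w = 0"
      using adapted_splitting.integer_normal_to_stable_unstable[OF adapted assms(1) k] by blast
    have "\<forall>x0 legs. su_cycle S U x0 legs \<longrightarrow> PCF F x0 legs (fourier_cos m) = 0"
      using PCF_fourier_cos_eq_0[OF assms(1) adapted_splitting.image_S[OF adapted]
          adapted_splitting.image_U[OF adapted] m(1,3)] by blast
    then obtain u K where "torus_fun u" "\<forall>x. fourier_cos m x = u (F *v x) - u x + K"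
      using assms(3) smooth_fourier_cos torus_fun_fourier_cos[OF m(1)] by blast
    then show False
      using fourier_cos_not_coboundary[OF assms(1) m(1,2)] by blast
  qed
  moreover have "0 \<in> C"
    using adapted_splitting.subspace_C[OF adapted] by (rule subspace_0)
  ultimately show ?thesis
    by auto
qed

end
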